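(* Let $\{\mu_i^k,\mathbf{G}_i^k\}$, $i\in V$, be generated by the algorithm CoBa-DD described in the context, with bounded initial values $\mu_i^0,\mathbf{G}_i^0$, and let $\bar\mu^k=\frac1n\sum_{i\in V}\mu_i^k$, $\bar{\mathbf{G}}^k=\frac1n\sum_{i\in V}\mathbf{G}_i^k$. Suppose the convexity/compactness, existence and Slater assumptions hold and that $\mathbf{W}$ satisfies the consensus-matrix conditions (all stated in the context). Let $\beta_0\ge c_0$ with $c_0$ as in the context, $M=L+Q$, $\delta\ge0$, $p=\frac{\nu^\delta\beta_0}{\beta_0+\alpha M}$, and $$\bar\varphi=\frac{\log(\beta_0)-\log\big(4n(1+d^2)(\beta_0+\alpha M)\big)}{\log(\nu)}.$$ If $\varphi\ge\bar\varphi+\delta$, then for all $i\in V$ $$\limsup_{k\to\infty}\|\mu_i^k-\bar\mu^k\|_2\le\frac{2p\,\alpha M}{1-p},\qquad \limsup_{k\to\infty}\|\mathbf{G}_i^k-\bar{\mathbf{G}}^k\|_{\mathrm F}\le\frac{2p\,\alpha M}{1-p}.$$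
   Context: Problem. Let $V=\{1,\dots,n\}$ be the nodes of an undirected time-invariant communication graph, with $N_i$ the set of neighbours of node $i$. For $i\in V$ let $f_i,g_i:\mathbb{R}\to\mathbb{R}$ be convex and $X_i\subset\mathbb{R}$ convex and compact; $X=\prod_{i\in V}X_i$. Let $\mathbf{A}_0,\mathbf{A}_i$ ($i\in V$) be real symmetric $d\times d$ matrices. The problem is $$\min_{x_i\in X_i,\,i\in V} f(\mathbf{x}):=\sum_{i\in V}f_i(x_i)\quad\text{s.t.}\quad \sum_{i\in V}g_i(x_i)\le 0,\quad \mathbf{A}_0+\sum_{i\in V}\mathbf{A}_ix_i\succeq 0.$$ Existence assumption: the feasible set $F$ is nonempty, $f(\mathbf{x})>-\infty$ for all $\mathbf{x}\in F$, and $f(\mathbf{x})<\infty$ for some $\mathbf{x}\in F$. Slater assumption: there is $\bar{\mathbf{x}}\in X$ with $\sum_i g_i(\bar x_i)<0$ and $\mathbf{A}_0+\sum_i\mathbf{A}_i\bar x_i\succ0$. Dual. $\mathbb{S}^d_+$ is the cone of positive semidefinite $d\times d$ matrices. For $\mu\in\mathbb{R}_+$, $\mathbf{G}\in\mathbb{S}_+^d$, let $L_i(x_i,\mu,\mathbf{G})=f_i(x_i)+\mu g_i(x_i)-\mathrm{tr}[(\mathbf{A}_0/n+\mathbf{A}_ix_i)\mathbf{G}]$, $q_i(\mu,\mathbf{G})=\min_{x_i\in X_i}L_i(x_i,\mu,\mathbf{G})$, $q=\sum_{i\in V}q_i$. Let $L=\max_{i\in V}\max_{x_i\in X_i}|g_i(x_i)|$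 and $Q=\max_{i\in V}\max_{x_i\in X_i}\|-\mathbf{A}_0/n-\mathbf{A}_ix_i\|_{\mathrm F}$. Consensus-matrix conditions. $\mathbf{W}\in\mathbb{R}^{n\times n}$ satisfies $[\mathbf{W}]_{ij}=0$ if $j\notin N_i\cup\{i\}$, $\mathbf{W}=\mathbf{W}^{\mathsf T}$, $\mathbf{W}\mathbf{1}_n=\mathbf{1}_n$, and the spectral radius of $\mathbf{W}-\mathbf{1}_n\mathbf{1}_n^{\mathsf T}/n$ is at most $\nu$, where $\nu<1$ (and $\nu>0$). Algorithm CoBa-DD. Fix $\alpha>0$, a number $\varphi\in\mathbb{N}$ of consensus steps, a Slater vector $\bar{\mathbf{x}}$, some $\tilde\mu\ge0,\tilde{\mathbf{G}}\succeq0$, set $\gamma=\min\{-\sum_i g_i(\bar x_i),\ \lambda_{\min}(\mathbf{A}_0+\sum_i\mathbf{A}_i\bar x_i)\}$, choose $r\ge (f(\bar{\mathbf{x}})-q(\tilde\mu,\tilde{\mathbf{G}}))/\gamma$, $r>0$, and let $D_\mu=\{\mu\ge0:|\mu|\le (f(\bar{\mathbf{x}})-q(\tilde\mu,\tilde{\mathbf{G}}))/\gamma+r\}$, $D_{\mathbf{G}}=\{\mathbf{G}\succeq0:\|\mathbf{G}\|_{\mathrm F}\le (f(\bar{\mathbf{x}})-q(\tilde\mu,\tilde{\mathbf{G}}))/\gamma+r\}$. Start from $\mu_i^0\in\mathbb{R}_+$, $\mathbf{G}_i^0\in\mathbb{S}_+^d$. For $k\ge0$ pick $\tilde x_i^k\in\mathrm{argmin}_{x_i\in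 X_i}L_i(x_i,\mu_i^k,\mathbf{G}_i^k)$, and update, with $\mathsf{P}_D$ the Euclidean (Frobenius) projection onto $D$, $$\mu_i^{k+1}=\mathsf{P}_{D_\mu}\Big[\sum_{j\in V}[\mathbf{W}^\varphi]_{ij}(\mu_j^k+\alpha g_j(\tilde x_j^k))\Big],\quad \mathbf{G}_i^{k+1}=\mathsf{P}_{D_{\mathbf{G}}}\Big[\sum_{j\in V}[\mathbf{W}^\varphi]_{ij}\big(\mathbf{G}_j^k-\alpha(\mathbf{A}_0/n+\mathbf{A}_j\tilde x_j^k)\big)\Big].$$ Constant $c_0$. $c_0\ge0$ is a number such that for all $i\in V$ $$\Big\|\sum_{j\in V}[\mathbf{W}^\varphi-\mathbf{1}_n\mathbf{1}_n^{\mathsf T}/n]_{ij}(\mu_j^0+\alpha g_j(\tilde x_j^0))\Big\|_2+\Big\|\sum_{j\in V}[\mathbf{W}^\varphi-\mathbf{1}_n\mathbf{1}_n^{\mathsf T}/n]_{ij}\big(\mathbf{G}_j^0-\alpha(\mathbf{A}_0/n+\mathbf{A}_j\tilde x_j^0)\big)\Big\|_{\mathrm F}\le c_0.$$ It is understood that $\beta_0>0$ and $M>0$, so that the logarithms and $1/(1-p)$ are defined. *)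

theory Defs
  imports "HOL-Analysis.Analysis"
begin

text \<open>
  The nodes are the elements of a finite type \<open>'n\<close>, so \<open>n = CARD('n)\<close>; a \<open>d \<times> d\<close> matrix is
  an element of \<open>real^'d^'d\<close> with \<open>d = CARD('d)\<close>. The library norm on \<open>real^'d^'d\<close> is the
  Frobenius norm, so \<open>closest_point\<close> is the Frobenius projection.
\<close>

section \<open>Matrices\<close>

definition psd :: "real^'d^'d \<Rightarrow> bool" where
  "psd S \<longleftrightarrow> transpose S = S \<and> (\<forall>v. 0 \<le> v \<bullet> (S *v v))"

definition pos_def :: "real^'d^'d \<Rightarrow> bool" where
  "pos_def S \<longleftrightarrow> transpose S = S \<and> (\<forall>v. v \<noteq> 0 \<longrightarrow> 0 < v \<bullet> (S *v v))"

definition eigenvalues :: "('a::field)^'m^'m \<Rightarrow> 'a set" where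
  "eigenvalues S = {c. \<exists>v. v \<noteq> 0 \<and> S *v v = c *s v}"

text \<open>Only meant for symmetric matrices, which have a real eigenvalue.\<close>

definition lambda_min :: "real^'m^'m \<Rightarrow> real" where
  "lambda_min S = Min (eigenvalues S)"

text \<open>All complex eigenvalues of the real matrix are taken into account.\<close>

definition spectral_radius :: "real^'m^'m \<Rightarrow> real" where
  "spectral_radius S = Max (cmod ` eigenvalues (\<chi> i j. complex_of_real (S $ i $ j)))"

primrec matpow :: "real^'m^'m \<Rightarrow> nat \<Rightarrow> real^'m^'m" where
  "matpow S 0 = mat 1"
| "matpow S (Suc k) = S ** matpow S k"

text \<open>The matrix \<open>1\<^sub>n 1\<^sub>n\<^sup>T / n\<close>.\<close>

definition avg_mat :: "real^'n^'n" where
  "avg_mat = (\<chi> i j. 1 / real CARD('n))"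

section \<open>The communication graph\<close>

definition neighbours :: "('n \<Rightarrow> 'n \<Rightarrow> bool) \<Rightarrow> 'n \<Rightarrow> 'n set" where
  "neighbours E i = {j. E i j}"

definition consensus_matrix :: "('n \<Rightarrow> 'n \<Rightarrow> bool) \<Rightarrow> real \<Rightarrow> real^'n^'n \<Rightarrow> bool" where
  "consensus_matrix E \<nu> W \<longleftrightarrow>
     (\<forall>i j. j \<notin> neighbours E i \<union> {i} \<longrightarrow> W $ i $ j = 0) \<and>
     W = transpose W \<and>
     W *v vec 1 = vec 1 \<and>
     spectral_radius (W - avg_mat) \<le> \<nu>"

section \<open>The primal problem\<close>

definition separable_sum :: "('n::finite \<Rightarrow> real \<Rightarrow> real) \<Rightarrow> ('n \<Rightarrow> real) \<Rightarrow> real" where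
  "separable_sum h x = (\<Sum>i\<in>UNIV. h i (x i))"

definition lmi :: "real^'d^'d \<Rightarrow> ('n::finite \<Rightarrow> real^'d^'d) \<Rightarrow> ('n \<Rightarrow> real) \<Rightarrow> real^'d^'d" where
  "lmi A0 A x = A0 + (\<Sum>i\<in>UNIV. x i *\<^sub>R A i)"

definition feasible_set ::
  "('n::finite \<Rightarrow> real \<Rightarrow> real) \<Rightarrow> ('n \<Rightarrow> real set) \<Rightarrow> real^'d^'d \<Rightarrow> ('n \<Rightarrow> real^'d^'d) \<Rightarrow> ('n \<Rightarrow> real) set"
  where
  "feasible_set g X A0 A = {x. (\<forall>i. x i \<in> X i) \<and> separable_sum g x \<le> 0 \<and> psd (lmi A0 A x)}"

definition slater_vector ::
  "('n::finite \<Rightarrow> real \<Rightarrow> real) \<Rightarrow> ('n \<Rightarrow> real set) \<Rightarrow> real^'d^'d \<Rightarrow> ('n \<Rightarrow> real^'d^'d) \<Rightarrow> ('n \<Rightarrow> real) \<Rightarrow> bool"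
  where
  "slater_vector g X A0 A x \<longleftrightarrow> (\<forall>i. x i \<in> X i) \<and> separable_sum g x < 0 \<and> pos_def (lmi A0 A x)"

section \<open>The dual problem\<close>

text \<open>The matrix \<open>A\<^sub>0 / n + A\<^sub>i x\<^sub>i\<close>.\<close>

definition lmi_loc :: "real^'d^'d \<Rightarrow> ('n::finite \<Rightarrow> real^'d^'d) \<Rightarrow> 'n \<Rightarrow> real \<Rightarrow> real^'d^'d" where
  "lmi_loc A0 A i y = (1 / real CARD('n)) *\<^sub>R A0 + y *\<^sub>R A i"

definition lagrangian ::
  "('n::finite \<Rightarrow> real \<Rightarrow> real) \<Rightarrow> ('n \<Rightarrow> real \<Rightarrow> real) \<Rightarrow> real^'d^'d \<Rightarrow> ('n \<Rightarrow> real^'d^'d)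
    \<Rightarrow> 'n \<Rightarrow> real \<Rightarrow> real \<Rightarrow> real^'d^'d \<Rightarrow> real"
  where
  "lagrangian f g A0 A i y \<mu> G = f i y + \<mu> * g i y - trace (lmi_loc A0 A i y ** G)"

text \<open>
  Minima and maxima over the sets \<open>X i\<close> are written as \<open>INF\<close> and \<open>SUP\<close>. They are attained in the
  intended setting: \<open>X i\<close> is nonempty and compact and the functions involved are continuous, because
  finite convex functions on the real line are continuous.
\<close>

definition dual_fun ::
  "('n::finite \<Rightarrow> real \<Rightarrow> real) \<Rightarrow> ('n \<Rightarrow> real \<Rightarrow> real) \<Rightarrow> ('n \<Rightarrow> real set)
    \<Rightarrow> real^'d^'d \<Rightarrow> ('n \<Rightarrow> real^'d^'d) \<Rightarrow> real \<Rightarrow> real^'d^'d \<Rightarrow> real"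
  where
  "dual_fun f g X A0 A \<mu> G = (\<Sum>i\<in>UNIV. INF y\<in>X i. lagrangian f g A0 A i y \<mu> G)"

definition g_bound :: "('n::finite \<Rightarrow> real \<Rightarrow> real) \<Rightarrow> ('n \<Rightarrow> real set) \<Rightarrow> real" where
  "g_bound g X = (MAX i. SUP y\<in>X i. \<bar>g i y\<bar>)"

definition lmi_bound ::
  "('n::finite \<Rightarrow> real set) \<Rightarrow> real^'d^'d \<Rightarrow> ('n \<Rightarrow> real^'d^'d) \<Rightarrow> real"
  where
  "lmi_bound X A0 A = (MAX i. SUP y\<in>X i. norm (- lmi_loc A0 A i y))"

definition D_mu :: "real \<Rightarrow> real set" where
  "D_mu \<rho> = {\<mu>. 0 \<le> \<mu> \<and> \<bar>\<mu>\<bar> \<le> \<rho>}"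

definition D_G :: "real \<Rightarrow> (real^'d^'d) set" where
  "D_G \<rho> = {G. psd G \<and> norm G \<le> \<rho>}"

section \<open>The algorithm\<close>

text \<open>
  One choice of minimisers together with the resulting iterates; \<open>\<rho>\<close> is the radius of the two
  projection sets.
\<close>

definition coba_dd ::
  "('n::finite \<Rightarrow> real \<Rightarrow> real) \<Rightarrow> ('n \<Rightarrow> real \<Rightarrow> real) \<Rightarrow> ('n \<Rightarrow> real set)
    \<Rightarrow> real^'d^'d \<Rightarrow> ('n \<Rightarrow> real^'d^'d) \<Rightarrow> real^'n^'n \<Rightarrow> nat \<Rightarrow> real \<Rightarrow> real
    \<Rightarrow> (nat \<Rightarrow> 'n \<Rightarrow> real) \<Rightarrow> (nat \<Rightarrow> 'n \<Rightarrow> real) \<Rightarrow> (nat \<Rightarrow> 'n \<Rightarrow> real^'d^'d) \<Rightarrow> bool"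
  where
  "coba_dd f g X A0 A W \<phi> \<alpha> \<rho> xt mu G \<longleftrightarrow>
     (\<forall>i. 0 \<le> mu 0 i \<and> psd (G 0 i)) \<and>
     (\<forall>k i. is_arg_min (\<lambda>y. lagrangian f g A0 A i y (mu k i) (G k i)) (\<lambda>y. y \<in> X i) (xt k i)) \<and>
     (\<forall>k i. mu (Suc k) i = closest_point (D_mu \<rho>)
        (\<Sum>j\<in>UNIV. matpow W \<phi> $ i $ j * (mu k j + \<alpha> * g j (xt k j)))) \<and>
     (\<forall>k i. G (Suc k) i = closest_point (D_G \<rho>)
        (\<Sum>j\<in>UNIV. matpow W \<phi> $ i $ j *\<^sub>R (G k j - \<alpha> *\<^sub>R lmi_loc A0 A j (xt k j))))"

end

theory Submission
  imports Defs
begin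

text \<open>
  Stack the multipliers as \<open>z\<^sub>i\<close> and the scaled subgradients as \<open>s\<^sub>i\<close>, and let
  \<open>e\<^sub>i = \<Sum>\<^sub>j (W\<^sup>\<phi> - 1 1\<^sup>T / n)\<^sub>i\<^sub>j (z\<^sub>j + s\<^sub>j)\<close> be the deviation of the argument of
  the projection from the exact average \<open>v\<close> of the \<open>z\<^sub>j + s\<^sub>j\<close>. Projections are nonexpansive, so
  all new iterates lie within \<open>max |e\<^sub>i|\<close> of the single point \<open>P v\<close>. The rows of
  \<open>W\<^sup>\<phi> - 1 1\<^sup>T / n\<close> sum to zero, so \<open>P v\<close> may be subtracted from the new iterates in
  the next error; its entries are bounded by \<open>\<nu>\<^sup>\<phi>\<close>, and \<open>n \<nu>\<^sup>\<phi> \<le> p\<close>. Hence the errors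
  satisfy \<open>b' \<le> p (b + \<alpha> M)\<close>, whose fixed point is \<open>p \<alpha> M / (1 - p)\<close>.
\<close>

section \<open>Symmetric matrices\<close>

lemma inner_symmetric_matrix:
  fixes S :: "real^'n^'n"
  assumes "transpose S = S"
  shows "(S *v x) \<bullet> y = x \<bullet> (S *v y)"
  by (metis assms dot_lmul_matrix transpose_matrix_vector)

text \<open>One eigenvector chosen per eigenvalue yields a pairwise orthogonal, hence independent,
  family. Finiteness makes the \<open>Max\<close> in \<open>spectral_radius\<close> a genuine
  maximum.\<close>

lemma finite_eigenvalues_symmetric:
  fixes S :: "real^'n^'n"
  assumes S: "transpose S = S"
  shows "finite (eigenvalues S)"
proof -
  have "\<forall>c\<in>eigenvalues S. \<exists>v. v \<noteq> 0 \<and> S *v v = c *\<^sub>R v"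
    by (auto simp: eigenvalues_def scalar_mult_eq_scaleR)
  then obtain w where w: "\<And>c. c \<in> eigenvalues S \<Longrightarrow> w c \<noteq> 0 \<and> S *v w c = c *\<^sub>R w c"
    by metis
  have orth: "w c \<bullet> w d = 0" if "c \<in> eigenvalues S" "d \<in> eigenvalues S" "c \<noteq> d" for c d
    using inner_symmetric_matrix[OF S, of "w c" "w d"] w[OF that(1)] w[OF that(2)] that(3) by auto
  have inj: "inj_on w (eigenvalues S)"
    by (rule inj_onI) (metis orth w inner_eq_zero_iff)
  have "pairwise orthogonal (w ` eigenvalues S)"
    using orth by (auto simp: pairwise_def orthogonal_def)
  moreover have "0 \<notin> w ` eigenvalues S"
    using w by force
  ultimately have "finite (w ` eigenvalues S)"
    using pairwise_orthogonal_independent independent_imp_finite by blast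
  then show ?thesis
    using inj finite_imageD by blast
qed

text \<open>Split a complex eigenvector into its real part \<open>a\<close> and imaginary part
  \<open>b\<close>; symmetry tested on this pair gives
  \<open>Im c * (a \<bullet> a + b \<bullet> b) = 0\<close>.\<close>

lemma complex_eigenvalues_symmetric:
  fixes S :: "real^'n^'n"
  assumes S: "transpose S = S"
  shows "eigenvalues (\<chi> i j. complex_of_real (S $ i $ j)) = complex_of_real ` eigenvalues S"
    (is "eigenvalues ?C = _")
proof (intro equalityI subsetI)
  fix c assume "c \<in> eigenvalues ?C"
  then obtain v where v: "v \<noteq> 0" "?C *v v = c *s v"
    by (auto simp: eigenvalues_def)
  define a where "a = (\<chi> i. Re (v $ i))"
  define b where "b = (\<chi> i. Im (v $ i))"
  have vi: "(\<Sum>j\<in>UNIV. complex_of_real (S $ i $ j) * v $ j) = c * v $ i" for i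
    using v(2) by (simp add: vec_eq_iff matrix_vector_mult_def)
  have Sa: "S *v a = Re c *\<^sub>R a - Im c *\<^sub>R b"
    using vi[THEN arg_cong[where f = Re]]
    by (simp add: vec_eq_iff matrix_vector_mult_def a_def b_def Re_sum)
  have Sb: "S *v b = Im c *\<^sub>R a + Re c *\<^sub>R b"
    using vi[THEN arg_cong[where f = Im]]
    by (simp add: vec_eq_iff matrix_vector_mult_def a_def b_def Im_sum add.commute)
  have "a \<noteq> 0 \<or> b \<noteq> 0"
    using v(1) by (auto simp: vec_eq_iff a_def b_def complex_eq_iff)
  then have "a \<bullet> a + b \<bullet> b \<noteq> 0"
    by (auto simp: add_nonneg_eq_0_iff)
  moreover have "Im c * (a \<bullet> a + b \<bullet> b) = 0"
    using inner_symmetric_matrix[OF S, of a b]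
    by (simp add: Sa Sb inner_simps inner_commute algebra_simps)
  ultimately have "Im c = 0"
    by simp
  then have "S *v a = Re c *s a" "S *v b = Re c *s b"
    using Sa Sb by (simp_all add: scalar_mult_eq_scaleR)
  then have "Re c \<in> eigenvalues S"
    using \<open>a \<noteq> 0 \<or> b \<noteq> 0\<close> by (auto simp: eigenvalues_def)
  then show "c \<in> complex_of_real ` eigenvalues S"
    using \<open>Im c = 0\<close> by (metis complex_is_Real_iff imageI of_real_Re)
next
  fix c assume "c \<in> complex_of_real ` eigenvalues S"
  then obtain l v where c: "c = complex_of_real l" and v: "v \<noteq> 0" "S *v v = l *s v"
    by (auto simp: eigenvalues_def)
  have "?C *v (\<chi> i. complex_of_real (v $ i)) = c *s (\<chi> i. complex_of_real (v $ i))"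
    using v(2)
    by (simp add: vec_eq_iff matrix_vector_mult_def c flip: of_real_mult of_real_sum)
  moreover have "(\<chi> i. complex_of_real (v $ i)) \<noteq> 0"
    using v(1) by (auto simp: vec_eq_iff)
  ultimately show "c \<in> eigenvalues ?C"
    unfolding eigenvalues_def by blast
qed

text \<open>Let \<open>l\<close> be the maximum of \<open>norm (S *v v)\<close> over the unit
  sphere. A maximiser \<open>v\<close> is an eigenvector of the square of \<open>S\<close> for
  \<open>l * l\<close>, so \<open>l\<close> or \<open>- l\<close> is an eigenvalue of
  \<open>S\<close>.\<close>

lemma norm_symmetric_le_spectral_radius:
  fixes S :: "real^'n^'n"
  assumes S: "transpose S = S"
  shows "norm (S *v x) \<le> spectral_radius S * norm x"
proof -
  have "continuous_on (sphere (0::real^'n) 1) (\<lambda>x. norm (S *v x))"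
    by (intro continuous_intros linear_continuous_on matrix_vector_mul_bounded_linear)
  moreover have "axis undefined 1 \<in> sphere (0::real^'n) 1"
    by (simp add: norm_axis_1)
  ultimately obtain v where v: "norm v = 1" and max: "\<And>u. norm u = 1 \<Longrightarrow> norm (S *v u) \<le> norm (S *v v)"
    using continuous_attains_sup[of "sphere (0::real^'n) 1" "\<lambda>x. norm (S *v x)"] by auto
  define l where "l = norm (S *v v)"
  have le: "norm (S *v u) \<le> l * norm u" for u
  proof (cases "u = 0")
    case False
    then have "norm (S *v (u /\<^sub>R norm u)) \<le> l"
      unfolding l_def by (intro max) simp
    then show ?thesis
      using False by (simp add: matrix_vector_mult_scaleR divide_simps mult.commute)
  qed simp
  have SS: "S *v (S *v v) = (l * l) *\<^sub>R v"
  proof -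
    \<comment> \<open>Equality in Cauchy-Schwarz: \<open>v \<bullet> S\<^sup>2 v = l\<^sup>2\<close> while \<open>|S\<^sup>2 v| \<le> l\<^sup>2\<close>.\<close>
    define y where "y = S *v (S *v v)"
    have "norm y \<le> l * l"
      using le[of "S *v v"] by (simp add: y_def l_def)
    then have "y \<bullet> y \<le> (l * l) * (l * l)"
      by (metis dot_square_norm mult_mono' norm_ge_zero power2_eq_square)
    moreover have "v \<bullet> y = l * l"
      using inner_symmetric_matrix[OF S, of v "S *v v"]
      by (simp add: y_def l_def dot_square_norm power2_eq_square)
    moreover have "v \<bullet> v = 1"
      using v by (simp add: dot_square_norm)
    ultimately have "(y - (l * l) *\<^sub>R v) \<bullet> (y - (l * l) *\<^sub>R v) \<le> 0"
      by (simp add: inner_simps inner_commute)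
    then show ?thesis
      by (metis eq_iff_diff_eq_0 inner_ge_zero inner_eq_zero_iff order_antisym y_def)
  qed
  \<comment> \<open>Here \<open>(S - l) (S + l) v = 0\<close>: either \<open>v\<close> is an
    eigenvector for \<open>- l\<close>, or the nonzero vector \<open>S *v v + l *\<^sub>R v\<close>
    is one for \<open>l\<close>.\<close>
  obtain c where c: "c \<in> eigenvalues S" "\<bar>c\<bar> = l"
  proof (cases "S *v v + l *\<^sub>R v = 0")
    case True
    then have "S *v v = (- l) *s v"
      by (simp add: scalar_mult_eq_scaleR add_eq_0_iff)
    then have "- l \<in> eigenvalues S"
      using v(1) unfolding eigenvalues_def by (intro CollectI exI[of _ v]) auto
    then show ?thesis
      using that by (simp add: l_def)
  next
    case False
    have "S *v (S *v v + l *\<^sub>R v) = l *s (S *v v + l *\<^sub>R v)"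
      using SS by (simp add: matrix_vector_right_distrib matrix_vector_mult_scaleR
          scalar_mult_eq_scaleR scaleR_add_right add.commute)
    then have "l \<in> eigenvalues S"
      using False by (auto simp: eigenvalues_def)
    then show ?thesis
      using that by (simp add: l_def)
  qed
  have "l \<le> spectral_radius S"
    unfolding spectral_radius_def complex_eigenvalues_symmetric[OF S]
    using c by (intro Max_ge) (auto intro!: finite_imageI finite_eigenvalues_symmetric[OF S]
        simp: image_image)
  then show ?thesis
    using le[of x] by (meson mult_right_mono norm_ge_zero order_trans)
qed

section \<open>Powers of the consensus matrix\<close>

lemma matpow_mult_vec_Suc: "matpow S (Suc k) *v x = S *v (matpow S k *v x)"
  by (simp add: matrix_vector_mul_assoc)

lemma matpow_fixed_vec: "S *v x = x \<Longrightarrow> matpow S k *v x = x"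
  by (induction k) (simp_all add: matpow_mult_vec_Suc del: matpow.simps(2))

lemma avg_mat_mult_vec: "avg_mat *v (x :: real^'n) = ((x \<bullet> vec 1) / real CARD('n)) *\<^sub>R vec 1"
  by (simp add: vec_eq_iff avg_mat_def matrix_vector_mult_def inner_vec_def sum_divide_distrib)

text \<open>On the orthogonal complement of \<open>vec 1\<close> the averaging matrix vanishes, so
  \<open>W\<close> acts there as \<open>W - avg_mat\<close>. This space is invariant because
  \<open>W\<close> is symmetric and fixes \<open>vec 1\<close>.\<close>

lemma norm_matpow_le:
  fixes W :: "real^'n^'n"
  assumes W: "W = transpose W" "W *v vec 1 = vec 1" "spectral_radius (W - avg_mat) \<le> \<nu>"
    and x: "x \<bullet> vec 1 = 0" and nu: "0 \<le> \<nu>"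
  shows "norm (matpow W k *v x) \<le> \<nu> ^ k * norm x"
proof -
  have sym: "transpose (W - avg_mat) = W - avg_mat"
    using W(1) by (simp add: vec_eq_iff transpose_def avg_mat_def)
  \<comment> \<open>Orthogonality to \<open>vec 1\<close> is carried along so that the contraction
    applies again at every power.\<close>
  have "norm (matpow W k *v x) \<le> \<nu> ^ k * norm x \<and> (matpow W k *v x) \<bullet> vec 1 = 0"
  proof (induction k)
    case 0
    then show ?case using x by simp
  next
    case (Suc k)
    let ?y = "matpow W k *v x"
    have "(W *v ?y) \<bullet> vec 1 = 0"
      using inner_symmetric_matrix[of W ?y "vec 1"] W Suc by simp
    moreover have "W *v ?y = (W - avg_mat) *v ?y"
      using Suc by (simp add: matrix_vector_mult_diff_rdistrib avg_mat_mult_vec)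
    then have "norm (W *v ?y) \<le> spectral_radius (W - avg_mat) * norm ?y"
      using norm_symmetric_le_spectral_radius[OF sym, of ?y] by simp
    then have "norm (W *v ?y) \<le> \<nu> * norm ?y"
      using W(3) by (meson mult_right_mono norm_ge_zero order_trans)
    moreover have "\<nu> * norm ?y \<le> \<nu> * (\<nu> ^ k * norm x)"
      using Suc nu by (intro mult_left_mono) auto
    ultimately show ?case
      unfolding matpow_mult_vec_Suc by (simp add: mult.assoc)
  qed
  then show ?thesis ..
qed

text \<open>The difference is a component of \<open>matpow W k\<close> applied to a basis vector
  minus its mean part, a vector of norm at most 1 in the contracted subspace.\<close>

lemma abs_matpow_diff_avg_le:
  fixes W :: "real^'n^'n"
  assumes W: "W = transpose W" "W *v vec 1 = vec 1" "spectral_radius (W - avg_mat) \<le> \<nu>"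
    and nu: "0 \<le> \<nu>"
  shows "\<bar>matpow W k $ i $ j - 1 / real CARD('n)\<bar> \<le> \<nu> ^ k"
proof -
  \<comment> \<open>\<open>u\<close> is the orthogonal projection of \<open>axis j 1\<close> onto
    the line of \<open>vec 1\<close>; powers of \<open>W\<close> fix it, which produces the
    subtracted \<open>1 / n\<close>.\<close>
  define u :: "real^'n" where "u = (1 / real CARD('n)) *\<^sub>R vec 1"
  have one: "vec 1 \<bullet> (vec 1 :: real^'n) = real CARD('n)"
    "axis j 1 \<bullet> (vec 1 :: real^'n) = 1" "vec 1 \<bullet> (axis j 1 :: real^'n) = 1"
    by (simp_all add: inner_axis inner_axis' del: vec_1) (simp add: inner_vec_def)
  have "norm (axis j 1 - u) ^ 2 = 1 - 1 / real CARD('n)"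
    unfolding power2_norm_eq_inner u_def
    by (simp add: inner_diff_left inner_diff_right one inner_axis_axis del: vec_1)
  also have "\<dots> \<le> 1"
    by simp
  finally have "norm (axis j 1 - u) \<le> 1"
    by (simp add: power2_le_iff_abs_le abs_square_le_1)
  then have "\<nu> ^ k * norm (axis j 1 - u) \<le> \<nu> ^ k"
    using nu by (intro mult_left_le) auto
  moreover have "(axis j 1 - u) \<bullet> vec 1 = 0"
    by (simp add: inner_diff_left u_def one del: vec_1)
  ultimately have "norm (matpow W k *v (axis j 1 - u)) \<le> \<nu> ^ k"
    using norm_matpow_le[OF W _ nu] by (meson order_trans)
  moreover have "matpow W k *v (axis j 1 - u) = matpow W k *v axis j 1 - u"
    using matpow_fixed_vec[OF W(2), of k]
    by (simp add: matrix_vector_mult_diff_distrib u_def matrix_vector_mult_scaleR)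
  then have "(matpow W k *v (axis j 1 - u)) $ i = matpow W k $ i $ j - 1 / real CARD('n)"
    by (simp add: matrix_vector_mult_basis column_def u_def)
  ultimately show ?thesis
    using component_le_norm_cart[of "matpow W k *v (axis j 1 - u)" i] by simp
qed

lemma matpow_row_sum:
  fixes W :: "real^'n^'n"
  assumes "W *v vec 1 = vec 1"
  shows "(\<Sum>j\<in>UNIV. matpow W k $ i $ j) = 1"
  using arg_cong[where f = "\<lambda>v. v $ i", OF matpow_fixed_vec[OF assms, of k]]
  by (simp add: matrix_vector_mult_def)

section \<open>Projected consensus iterations\<close>

text \<open>The empty set is allowed: all its projections are the same unspecified point.\<close>

lemma closest_point_nonexpansive:
  fixes D :: "'a::euclidean_space set"
  assumes "convex D" "closed D"
  shows "norm (closest_point D x - closest_point D y) \<le> norm (x - y)"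
proof (cases "D = {}")
  case True
  then show ?thesis by (simp add: closest_point_def)
next
  case False
  then show ?thesis
    using closest_point_lipschitz[OF assms False, of x y] by (simp add: dist_norm)
qed

text \<open>The general space and set let one statement serve both scalar and matrix multipliers.
  Start values enter only through the largest initial error, whose weight \<open>q ^ k\<close> dies
  out.\<close>

lemma projected_consensus_limsup:
  fixes P :: "real^'n^'n" and z s :: "nat \<Rightarrow> 'n \<Rightarrow> 'a::euclidean_space"
  assumes D: "convex D" "closed D"
    and row: "\<And>i. (\<Sum>j\<in>UNIV. P $ i $ j) = 1"
    and entry: "\<And>i j. \<bar>P $ i $ j - 1 / real CARD('n)\<bar> \<le> \<eta>"
    and contr: "real CARD('n) * \<eta> \<le> q" "0 \<le> q" "q < 1"
    and s: "\<And>k j. norm (s k j) \<le> m"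
    and step: "\<And>k i. z (Suc k) i = closest_point D (\<Sum>j\<in>UNIV. P $ i $ j *\<^sub>R (z k j + s k j))"
  shows "limsup (\<lambda>k. ereal (norm (z k i - (1 / real CARD('n)) *\<^sub>R (\<Sum>j\<in>UNIV. z k j))))
           \<le> ereal (2 * q * m / (1 - q))"
proof -
  let ?n = "real CARD('n)"
  define v where "v k = (1 / ?n) *\<^sub>R (\<Sum>j\<in>UNIV. z k j + s k j)" for k
  define e where "e k i = (\<Sum>j\<in>UNIV. (P $ i $ j - 1 / ?n) *\<^sub>R (z k j + s k j))" for k i
  define c where "c k = closest_point D (v k)" for k
  have near: "norm (z (Suc k) i - c k) \<le> norm (e k i)" for k i
  proof -
    have "(\<Sum>j\<in>UNIV. P $ i $ j *\<^sub>R (z k j + s k j)) - v k = e k i"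
      by (simp add: v_def e_def scaleR_left_diff_distrib sum_subtractf scaleR_sum_right)
    then show ?thesis
      using closest_point_nonexpansive[OF D, of _ "v k"] by (metis step c_def)
  qed
  \<comment> \<open>The triangle inequality over the \<open>n\<close> entries of a row turns the
    entry bound \<open>\<eta>\<close> into the factor \<open>q\<close>.\<close>
  have bound: "norm (\<Sum>j\<in>UNIV. (P $ i $ j - 1 / ?n) *\<^sub>R w j) \<le> q * B"
    if "\<And>j. norm (w j) \<le> B" for i B and w :: "'n \<Rightarrow> 'a"
  proof -
    have B: "0 \<le> B"
      using that[of undefined] norm_ge_zero order_trans by blast
    have "norm (\<Sum>j\<in>UNIV. (P $ i $ j - 1 / ?n) *\<^sub>R w j) \<le> (\<Sum>j\<in>(UNIV::'n set). \<eta> * B)"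
      using entry that B
      by (intro order_trans[OF norm_sum] sum_mono)
         (metis (no_types, lifting) abs_ge_zero mult_mono' norm_ge_zero norm_scaleR)
    also have "\<dots> = (?n * \<eta>) * B"
      by simp
    also have "\<dots> \<le> q * B"
      using contr(1) B by (rule mult_right_mono)
    finally show ?thesis .
  qed
  define l where "l = q * m / (1 - q)"
  have l: "q * (l + m) = l"
    using contr(3) by (simp add: l_def field_simps)
  define b0 where "b0 = (MAX i. norm (e 0 i))"
  \<comment> \<open>The right side solves the recursion \<open>b \<mapsto> q * (b + m)\<close>
    started at \<open>b0\<close>, written around its fixed point \<open>l\<close>.\<close>
  have e_le: "norm (e k i) \<le> l + q ^ k * (b0 - l)" for k i
  proof (induction k arbitrary: i)
    case 0
    then show ?case by (simp add: b0_def)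
  next
    case (Suc k)
    have "(\<Sum>j\<in>UNIV. P $ i $ j - 1 / ?n) = 0"
      using row[of i] by (simp add: sum_subtractf)
    then have "(\<Sum>j\<in>UNIV. (P $ i $ j - 1 / ?n) *\<^sub>R c k) = 0"
      by (simp flip: scaleR_left.sum)
    then have "e (Suc k) i = (\<Sum>j\<in>UNIV. (P $ i $ j - 1 / ?n) *\<^sub>R ((z (Suc k) j - c k) + s (Suc k) j))"
      by (simp add: e_def scaleR_add_right scaleR_diff_right sum.distrib sum_subtractf)
    also have "norm \<dots> \<le> q * (l + q ^ k * (b0 - l) + m)"
      by (intro bound norm_triangle_le add_mono s order_trans[OF near Suc])
    also have "\<dots> = l + q ^ Suc k * (b0 - l)"
      using l by (simp add: algebra_simps)
    finally show ?case .
  qed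
  \<comment> \<open>The index is shifted because iterate \<open>Suc k\<close> is controlled by the
    error of step \<open>k\<close>.\<close>
  define h where "h k = 2 * (l + q ^ (k - 1) * (b0 - l))" for k
  have dev: "norm (z (Suc k) i - (1 / ?n) *\<^sub>R (\<Sum>j\<in>UNIV. z (Suc k) j)) \<le> h (Suc k)" for k
  proof -
    let ?b = "l + q ^ k * (b0 - l)"
    have close: "norm (z (Suc k) j - c k) \<le> ?b" for j
      using near e_le order_trans by blast
    \<comment> \<open>The mean of the iterates lies as close to \<open>c k\<close> as they do;
      comparing both with \<open>c k\<close> costs the factor 2.\<close>
    have "(1 / ?n) *\<^sub>R (\<Sum>j\<in>UNIV. z (Suc k) j) - c k = (1 / ?n) *\<^sub>R (\<Sum>j\<in>UNIV. z (Suc k) j - c k)"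
      by (simp add: sum_subtractf scaleR_diff_right sum_constant_scaleR)
    moreover have "norm (\<Sum>j\<in>(UNIV::'n set). z (Suc k) j - c k) \<le> ?n * ?b"
      using sum_norm_le[of UNIV "\<lambda>j. z (Suc k) j - c k" "\<lambda>_. ?b"] close by simp
    ultimately have avg: "norm ((1 / ?n) *\<^sub>R (\<Sum>j\<in>UNIV. z (Suc k) j) - c k) \<le> ?b"
      by (simp add: field_simps)
    have "norm ((z (Suc k) i - c k) - ((1 / ?n) *\<^sub>R (\<Sum>j\<in>UNIV. z (Suc k) j) - c k)) \<le> ?b + ?b"
      by (rule order_trans[OF norm_triangle_ineq4 add_mono[OF close avg]])
    then show ?thesis
      by (simp add: h_def mult.commute)
  qed
  have "(\<lambda>k. 2 * (l + q ^ k * (b0 - l))) \<longlonglongrightarrow> 2 * (l + 0 * (b0 - l))"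
    using contr(2,3) by (intro tendsto_intros LIMSEQ_power_zero) simp_all
  then have "(\<lambda>k. h (Suc k)) \<longlonglongrightarrow> 2 * l"
    by (simp add: h_def)
  then have "h \<longlonglongrightarrow> 2 * l"
    by (rule LIMSEQ_imp_Suc)
  then have lim: "limsup (\<lambda>k. ereal (h k)) = ereal (2 * l)"
    by (intro lim_imp_Limsup) auto
  \<comment> \<open>Index 0 is left out: the start values are not projections and \<open>h 0\<close>
    need not bound them.\<close>
  have "\<forall>\<^sub>F k in sequentially. ereal (norm (z k i - (1 / ?n) *\<^sub>R (\<Sum>j\<in>UNIV. z k j))) \<le> ereal (h k)"
    using eventually_gt_at_top[of 0]
    by eventually_elim (metis dev ereal_less_eq(3) gr0_implies_Suc)
  then have "limsup (\<lambda>k. ereal (norm (z k i - (1 / ?n) *\<^sub>R (\<Sum>j\<in>UNIV. z k j))))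
      \<le> limsup (\<lambda>k. ereal (h k))"
    by (rule Limsup_mono)
  then show ?thesis
    by (simp add: lim l_def mult.assoc)
qed

section \<open>Projection sets and subgradient bounds\<close>

lemma D_mu_eq: "D_mu \<rho> = {0..\<rho>}"
  by (auto simp: D_mu_def)

text \<open>Each condition on the right is an equation or inequality between linear maps of
  \<open>S\<close>, so closedness and convexity can be read off one condition at a time.\<close>

lemma psd_set_eq:
  "Collect psd = {S :: real^'d^'d. transpose S = S} \<inter> (\<Inter>v. {S. 0 \<le> v \<bullet> (S *v v)})"
  by (auto simp: psd_def)

lemma D_G_eq: "D_G \<rho> = Collect psd \<inter> cball 0 \<rho>"
  by (auto simp: D_G_def)

lemma linear_transpose: "linear (transpose :: real^'d^'d \<Rightarrow> real^'d^'d)"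
  by (intro linearI) (simp_all add: vec_eq_iff transpose_def)

lemma linear_quadratic_form: "linear (\<lambda>S :: real^'d^'d. v \<bullet> (S *v v))"
  by (intro linearI)
     (simp_all add: matrix_vector_mult_add_rdistrib inner_add_right scaleR_matrix_vector_assoc[symmetric])

lemma closed_D_G: "closed (D_G \<rho> :: (real^'d^'d) set)"
  unfolding D_G_eq psd_set_eq
  by (intro closed_Int closed_INT ballI closed_Collect_eq closed_Collect_le closed_cball
      continuous_on_const continuous_on_id
      linear_continuous_on[OF linear_conv_bounded_linear[THEN iffD1, OF linear_transpose]]
      linear_continuous_on[OF linear_conv_bounded_linear[THEN iffD1, OF linear_quadratic_form]])

lemma convex_D_G: "convex (D_G \<rho> :: (real^'d^'d) set)"
proof -
  have "convex {S :: real^'d^'d. transpose S = S}"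
    by (rule convexI) (simp add: linear_add[OF linear_transpose] linear_cmul[OF linear_transpose])
  moreover have "convex {S :: real^'d^'d. 0 \<le> v \<bullet> (S *v v)}" for v
    by (rule convexI) (simp add: linear_add[OF linear_quadratic_form] linear_cmul[OF linear_quadratic_form])
  ultimately show ?thesis
    unfolding D_G_eq psd_set_eq by (intro convex_Int convex_INT ballI convex_cball)
qed

text \<open>Compactness and continuity bound the image from above, so that the real
  \<open>SUP\<close> is an upper bound.\<close>

lemma le_Max_SUP:
  fixes h :: "'n::finite \<Rightarrow> 'b::topological_space \<Rightarrow> real"
  assumes "compact (X i)" "continuous_on (X i) (h i)" "y \<in> X i"
  shows "h i y \<le> (MAX i. SUP y\<in>X i. h i y)"
proof -
  have "bdd_above (h i ` X i)"
    using assms(1,2) by (intro bounded_imp_bdd_above compact_imp_bounded compact_continuous_image)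
  then have "h i y \<le> (SUP y\<in>X i. h i y)"
    using assms(3) by (intro cSUP_upper)
  also have "\<dots> \<le> (MAX i. SUP y\<in>X i. h i y)"
    by (intro Max_ge) auto
  finally show ?thesis .
qed

text \<open>Convexity on the whole line, an open set, gives continuity on all of \<open>X i\<close>,
  endpoints included.\<close>

lemma abs_le_g_bound:
  assumes "convex_on UNIV (g i)" "compact (X i)" "y \<in> X i"
  shows "\<bar>g i y\<bar> \<le> g_bound g X"
proof -
  have "continuous_on (X i) (g i)"
    using convex_on_continuous[OF open_UNIV assms(1)] continuous_on_subset by blast
  then show ?thesis
    unfolding g_bound_def using assms(2,3)
    by (intro le_Max_SUP[where h = "\<lambda>i y. \<bar>g i y\<bar>"] continuous_intros)
qed

lemma norm_lmi_loc_le_lmi_bound: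
  assumes "compact (X i)" "y \<in> X i"
  shows "norm (lmi_loc A0 A i y) \<le> lmi_bound X A0 A"
proof -
  have "norm (- lmi_loc A0 A i y) \<le> lmi_bound X A0 A"
    unfolding lmi_bound_def using assms
    by (intro le_Max_SUP[where h = "\<lambda>i y. norm (- lmi_loc A0 A i y)"])
       (auto simp: lmi_loc_def intro!: continuous_intros)
  then show ?thesis
    by simp
qed


theorem corollary5p1:
  fixes E :: "'n::finite \<Rightarrow> 'n \<Rightarrow> bool"
    and f g :: "'n \<Rightarrow> real \<Rightarrow> real"
    and X :: "'n \<Rightarrow> real set"
    and A0 :: "real^'d^'d" and A :: "'n \<Rightarrow> real^'d^'d"
    and W :: "real^'n^'n"
    and xbar :: "'n \<Rightarrow> real"
    and mut :: real and Gt :: "real^'d^'d"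
    and mu xt :: "nat \<Rightarrow> 'n \<Rightarrow> real" and G :: "nat \<Rightarrow> 'n \<Rightarrow> real^'d^'d"
    and \<nu> \<alpha> \<gamma> r \<rho> c0 \<beta>0 M \<delta> p \<phi>bar :: real
    and \<phi> :: nat
  assumes undirected: "symp E"
    and convex_fun: "\<And>i. convex_on UNIV (f i)" "\<And>i. convex_on UNIV (g i)"
    and convex_compact: "\<And>i. convex (X i)" "\<And>i. compact (X i)"
    and symmetric: "transpose A0 = A0" "\<And>i. transpose (A i) = A i"
    and feasible: "feasible_set g X A0 A \<noteq> {}"
    and slater: "slater_vector g X A0 A xbar"
    and nu: "0 < \<nu>" "\<nu> < 1"
    and consensus: "consensus_matrix E \<nu> W"
    and alpha: "0 < \<alpha>"
    and dual_point: "0 \<le> mut" "psd Gt"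
    and gamma: "\<gamma> = min (- separable_sum g xbar) (lambda_min (lmi A0 A xbar))"
    and r: "(separable_sum f xbar - dual_fun f g X A0 A mut Gt) / \<gamma> \<le> r" "0 < r"
    and rho: "\<rho> = (separable_sum f xbar - dual_fun f g X A0 A mut Gt) / \<gamma> + r"
    and run: "coba_dd f g X A0 A W \<phi> \<alpha> \<rho> xt mu G"
    and c0: "0 \<le> c0"
      "\<And>i. norm (\<Sum>j\<in>UNIV. (matpow W \<phi> - avg_mat) $ i $ j * (mu 0 j + \<alpha> * g j (xt 0 j)))
        + norm (\<Sum>j\<in>UNIV. (matpow W \<phi> - avg_mat) $ i $ j *\<^sub>R
                  (G 0 j - \<alpha> *\<^sub>R lmi_loc A0 A j (xt 0 j))) \<le> c0"
    and beta0: "c0 \<le> \<beta>0" "0 < \<beta>0"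
    and M: "M = g_bound g X + lmi_bound X A0 A" "0 < M"
    and delta: "0 \<le> \<delta>"
    and p: "p = \<nu> powr \<delta> * \<beta>0 / (\<beta>0 + \<alpha> * M)"
    and phibar: "\<phi>bar = (ln \<beta>0 - ln (4 * real CARD('n) * (1 + (real CARD('d))\<^sup>2) * (\<beta>0 + \<alpha> * M))) / ln \<nu>"
    and phi: "\<phi>bar + \<delta> \<le> real \<phi>"
  shows "\<forall>i. limsup (\<lambda>k. ereal (norm (mu k i - (\<Sum>j\<in>UNIV. mu k j) / real CARD('n))))
               \<le> ereal (2 * p * \<alpha> * M / (1 - p))
           \<and> limsup (\<lambda>k. ereal (norm (G k i - (1 / real CARD('n)) *\<^sub>R (\<Sum>j\<in>UNIV. G k j))))
               \<le> ereal (2 * p * \<alpha> * M / (1 - p))"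
proof -
  let ?n = "real CARD('n)" and ?d = "4 * (1 + (real CARD('d))\<^sup>2)"
  have W: "W = transpose W" "W *v vec 1 = vec 1" "spectral_radius (W - avg_mat) \<le> \<nu>"
    using consensus by (auto simp: consensus_matrix_def)
  have aM: "0 < \<alpha> * M"
    using alpha M(2) by simp
  have rate: "?n * \<nu> ^ \<phi> \<le> p"
  proof -
    have "\<nu> ^ \<phi> = \<nu> powr real \<phi>"
      using nu(1) by (simp add: powr_realpow)
    \<comment> \<open>The base lies below 1, so a larger exponent gives a smaller power.\<close>
    also have "\<dots> \<le> \<nu> powr (\<phi>bar + \<delta>)"
      using nu phi by (intro powr_mono') auto
    also have "\<dots> = \<nu> powr \<phi>bar * \<nu> powr \<delta>"
      by (rule powr_add)
    \<comment> \<open>\<open>\<phi>bar\<close> is a logarithm to base \<open>\<nu>\<close>, so this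
      power is the quotient whose logarithm was taken.\<close>
    also have "\<nu> powr \<phi>bar = exp (ln \<beta>0 - ln (4 * ?n * (1 + (real CARD('d))\<^sup>2) * (\<beta>0 + \<alpha> * M)))"
      using nu by (simp add: powr_def phibar)
    also have "\<dots> = \<beta>0 / (4 * ?n * (1 + (real CARD('d))\<^sup>2) * (\<beta>0 + \<alpha> * M))"
      using beta0(2) aM by (subst exp_diff, subst (1 2) exp_ln) (auto intro!: mult_pos_pos add_pos_nonneg)
    finally have "?n * \<nu> ^ \<phi> \<le> ?n * (\<beta>0 / (4 * ?n * (1 + (real CARD('d))\<^sup>2) * (\<beta>0 + \<alpha> * M)) * \<nu> powr \<delta>)"
      by (intro mult_left_mono) auto
    \<comment> \<open>The factor \<open>n\<close> cancels against the one inside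
      \<open>\<phi>bar\<close>; what remains of the constant is \<open>?d\<close>, which is at least
      1.\<close>
    also have "\<dots> = p / ?d"
      by (simp add: p mult_ac)
    also have "\<dots> \<le> p"
    proof -
      have "0 \<le> p"
        using beta0(2) aM by (simp add: p)
      moreover have "1 \<le> ?d"
        by (simp add: add_increasing2)
      ultimately have "p / ?d \<le> p / 1"
        by (intro divide_left_mono) (auto simp: add_pos_nonneg)
      then show ?thesis
        by simp
    qed
    finally show ?thesis .
  qed
  have p01: "0 \<le> p" "p < 1"
  proof -
    show "0 \<le> p"
      using beta0(2) aM by (simp add: p)
    \<comment> \<open>The numerator of \<open>p\<close> is at most \<open>\<beta>0\<close>;
      positivity of \<open>\<alpha> * M\<close> makes the quotient strictly less than 1.\<close>
    have "\<nu> powr \<delta> * \<beta>0 \<le> 1 * \<beta>0"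
      using nu delta beta0(2) by (intro mult_right_mono powr_le1) auto
    then have "\<nu> powr \<delta> * \<beta>0 < \<beta>0 + \<alpha> * M"
      using aM by linarith
    then show "p < 1"
      using beta0(2) aM by (simp add: p)
  qed
  have X: "xt k i \<in> X i" for k i
    using run by (auto simp: coba_dd_def is_arg_min_def)
  have gb: "\<bar>g i (xt k i)\<bar> \<le> g_bound g X" for k i
    using abs_le_g_bound convex_fun(2) convex_compact(2) X by blast
  have lb: "norm (lmi_loc A0 A i (xt k i)) \<le> lmi_bound X A0 A" for k i
    using norm_lmi_loc_le_lmi_bound convex_compact(2) X by blast
  \<comment> \<open>Each summand of \<open>M\<close> dominates a norm and is therefore nonnegative,
    so each is at most \<open>M\<close>.\<close>
  have gM: "\<bar>g i (xt k i)\<bar> \<le> M" for k i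
    using gb[where k = k and i = i] order_trans[OF norm_ge_zero lb[where k = k and i = i]] M(1) by linarith
  have lM: "norm (lmi_loc A0 A i (xt k i)) \<le> M" for k i
    using lb[where k = k and i = i] order_trans[OF abs_ge_zero gb[where k = k and i = i]] M(1) by linarith
  note entry = abs_matpow_diff_avg_le[OF W less_imp_le[OF nu(1)], of \<phi>]
  note row = matpow_row_sum[OF W(2), of \<phi>]
  \<comment> \<open>The scalar instance, with shift \<open>\<alpha> * g j (xt k j)\<close>; on the
    reals \<open>*\<^sub>R\<close> is multiplication.\<close>
  have "limsup (\<lambda>k. ereal (norm (mu k i - (1 / ?n) *\<^sub>R (\<Sum>j\<in>UNIV. mu k j)))) \<le> ereal (2 * p * (\<alpha> * M) / (1 - p))" for i
  proof (rule projected_consensus_limsup[OF _ _ row entry rate p01])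
    show "convex (D_mu \<rho>)" "closed (D_mu \<rho>)"
      by (auto simp: D_mu_eq)
    show "norm (\<alpha> * g j (xt k j)) \<le> \<alpha> * M" for k j
      using gM alpha by (simp add: abs_mult)
    show "mu (Suc k) i = closest_point (D_mu \<rho>) (\<Sum>j\<in>UNIV. matpow W \<phi> $ i $ j *\<^sub>R (mu k j + \<alpha> * g j (xt k j)))" for k i
      using run by (simp add: coba_dd_def)
  qed
  moreover have "limsup (\<lambda>k. ereal (norm (G k i - (1 / ?n) *\<^sub>R (\<Sum>j\<in>UNIV. G k j)))) \<le> ereal (2 * p * (\<alpha> * M) / (1 - p))" for i
  proof (rule projected_consensus_limsup[OF convex_D_G closed_D_G row entry rate p01])
    \<comment> \<open>The minus sign of the matrix update is absorbed into the shift.\<close>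
    show "norm (- \<alpha> *\<^sub>R lmi_loc A0 A j (xt k j)) \<le> \<alpha> * M" for k j
      using lM alpha by simp
    show "G (Suc k) i = closest_point (D_G \<rho>)
        (\<Sum>j\<in>UNIV. matpow W \<phi> $ i $ j *\<^sub>R (G k j + - \<alpha> *\<^sub>R lmi_loc A0 A j (xt k j)))" for k i
      using run by (simp add: coba_dd_def)
  qed
  ultimately show ?thesis
    by (simp add: mult.assoc)
qed

end
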